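(* Let $a,b$ be axes in $A$, let $x_0\in A_0(a)$ and $x_{1/2}\in A_{1/2}(a)$. Then: (1) $(x_{1/2}b_0)b_0=\frac12(1-(a,b))\,x_{1/2}b_0$. (2) $(x_0b_0)b_0=\frac12(1-(a,b))\,x_0b_0+\frac12(b,x_0)b_0$. (3) $(x_0b_{1/2})b_{1/2}=\frac12(a,b)(b,x_0)a+\frac12(a,b)\,x_0b_0$. (4)(a) $\big(x_{1/2}b_{1/2}\big)_0b_{1/2}=\frac14(a,b)(1-(a,b))x_{1/2}-\frac12(a,b)\,x_{1/2}b_0+\frac14(b,x_{1/2})b_{1/2}$. (4)(b) $(x_{1/2}b_{1/2})b_{1/2}=\frac14(a,b)(1-(a,b))x_{1/2}-\frac12(a,b)\,x_{1/2}b_0+\frac12(b,x_{1/2})b_{1/2}$. (5) $(x_{1/2}b_0)b_{1/2}=\frac14(1-(a,b))(b,x_{1/2})a+\frac14(b,x_{1/2})b_0$. (6) $(x_{1/2}b_{1/2})b_0=\frac12(1-(a,b))\big(b_{1/2}x_{1/2}\big)_0+\frac14(b,x_{1/2})b_0$. (7) $(x_0b_0)b_{1/2}=\frac12(1-(a,b))\,b_{1/2}x_0+\frac14(b,x_0)b_{1/2}$. (8) $(x_0b_{1/2})b_0=\frac14(b,x_0)b_{1/2}$.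
   Context: $\mathbb{F}$ is a field of characteristic not $2$ and $A$ is a commutative, not necessarily associative, $\mathbb{F}$-algebra equipped with a Frobenius form, i.e. a symmetric bilinear form $(\cdot,\cdot):A\times A\to\mathbb{F}$ with $(xy,z)=(x,yz)$ for all $x,y,z\in A$. For $z\in A$ and $\lambda\in\mathbb{F}$ put $A_\lambda(z)=\{x\in A: zx=\lambda x\}$. An axis is an idempotent $c\in A$ (so $c^2=c$) such that $(c,c)=1$, $A=\mathbb{F}c\oplus A_0(c)\oplus A_{1/2}(c)$, and the fusion rules hold: for $x_0,y_0\in A_0(c)$ and $x_{1/2},y_{1/2}\in A_{1/2}(c)$ one has $x_0y_0\in A_0(c)$, $x_0y_{1/2}\in A_{1/2}(c)$, $x_{1/2}y_{1/2}\in\mathbb{F}c+A_0(c)$. Given the axis $a$, each $x\in A$ is written uniquely $x=(a,x)a+x_0+x_{1/2}$ with $x_\lambda\in A_\lambda(a)$, $\lambda\in\{0,\frac12\}$; $(x)_0$ and $(x)_{1/2}$ also denote these components. In particular $b=(a,b)a+b_0+b_{1/2}$. *)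

theory Defs
  imports Complex_Main
begin

text \<open>
  The algebra \<open>A\<close> is a type with an explicit scalar multiplication and an explicit product, since
  the ring type classes require associativity. Linearity of the product and of the form in the
  other argument follows from commutativity and symmetry.
\<close>

locale frobenius_algebra = vector_space scale
  for scale :: "'f::field \<Rightarrow> 'a::ab_group_add \<Rightarrow> 'a" (infixr \<open>*s\<close> 75) +
  fixes mul :: "'a \<Rightarrow> 'a \<Rightarrow> 'a" (infixl \<open>\<cdot>\<close> 70)
    and form :: "'a \<Rightarrow> 'a \<Rightarrow> 'f"
  assumes mul_commute: "x \<cdot> y = y \<cdot> x"
    and mul_linear: "Vector_Spaces.linear (*s) (*s) ((\<cdot>) x)"
    and form_sym: "form x y = form y x"
    and form_linear: "Vector_Spaces.linear (*s) (*) (form x)"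
    and form_assoc: "form (x \<cdot> y) z = form x (y \<cdot> z)"

definition eigenspace ::
  "('f \<Rightarrow> 'a \<Rightarrow> 'a) \<Rightarrow> ('a \<Rightarrow> 'a \<Rightarrow> 'a) \<Rightarrow> 'a \<Rightarrow> 'f \<Rightarrow> 'a set"
  where "eigenspace scale mul z l = {x. mul z x = scale l x}"

definition axis ::
  "('f::field \<Rightarrow> 'a::ab_group_add \<Rightarrow> 'a) \<Rightarrow> ('a \<Rightarrow> 'a \<Rightarrow> 'a) \<Rightarrow> ('a \<Rightarrow> 'a \<Rightarrow> 'f) \<Rightarrow> 'a \<Rightarrow> bool"
  where "axis scale mul form c \<longleftrightarrow>
    (let Fc = range (\<lambda>t. scale t c);
         A0 = eigenspace scale mul c 0;
         Ah = eigenspace scale mul c (1/2)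
     in mul c c = c \<and> form c c = 1 \<and>
        (\<forall>x. \<exists>!(u, y, z). u \<in> Fc \<and> y \<in> A0 \<and> z \<in> Ah \<and> x = u + y + z) \<and>
        (\<forall>x\<in>A0. \<forall>y\<in>A0. mul x y \<in> A0) \<and>
        (\<forall>x\<in>A0. \<forall>y\<in>Ah. mul x y \<in> Ah) \<and>
        (\<forall>x\<in>Ah. \<forall>y\<in>Ah. \<exists>u\<in>Fc. \<exists>v\<in>A0. mul x y = u + v))"

text \<open>The components \<open>(x)\<^sub>0\<close> and \<open>(x)\<^sub>1\<^sub>/\<^sub>2\<close> of \<open>x\<close> with respect to \<open>c\<close>; meaningful when \<open>c\<close> is an axis.\<close>

definition zero_part ::
  "('f::field \<Rightarrow> 'a::ab_group_add \<Rightarrow> 'a) \<Rightarrow> ('a \<Rightarrow> 'a \<Rightarrow> 'a) \<Rightarrow> ('a \<Rightarrow> 'a \<Rightarrow> 'f) \<Rightarrow> 'a \<Rightarrow> 'a \<Rightarrow> 'a"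
  where "zero_part scale mul form c x =
    (THE y. y \<in> eigenspace scale mul c 0 \<and>
       (\<exists>z\<in>eigenspace scale mul c (1/2). x = scale (form c x) c + y + z))"

definition half_part ::
  "('f::field \<Rightarrow> 'a::ab_group_add \<Rightarrow> 'a) \<Rightarrow> ('a \<Rightarrow> 'a \<Rightarrow> 'a) \<Rightarrow> ('a \<Rightarrow> 'a \<Rightarrow> 'f) \<Rightarrow> 'a \<Rightarrow> 'a \<Rightarrow> 'a"
  where "half_part scale mul form c x =
    (THE z. z \<in> eigenspace scale mul c (1/2) \<and>
       (\<exists>y\<in>eigenspace scale mul c 0. x = scale (form c x) c + y + z))"

end

theory Submission
  imports Defs
begin

text \<open>
  Put \<open>\<alpha> = (a,b)\<close> and let \<open>L\<^sub>b\<close> be multiplication by \<open>b\<close>. Three facts about the axis \<open>b\<close> are expanded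
  in components with respect to \<open>a\<close> and split into their parts in \<open>\<F>a + A\<^sub>0(a)\<close> (even) and
  \<open>A\<^sub>1\<^sub>/\<^sub>2(a)\<close> (odd).

  First, \<open>2b(bx) = bx + (b,x)b\<close>. Secondly, \<open>w = a + b - 2ab = (1 - \<alpha>)a + b\<^sub>0\<close> is symmetric in \<open>a\<close> and
  \<open>b\<close> and lies in \<open>\<F>b + A\<^sub>0(b)\<close>, so \<open>L\<^sub>b\<close> commutes with multiplication by \<open>w\<close> (Seress) and
  \<open>bw = (1 - \<alpha>)b\<close>; the latter gives \<open>b\<^sub>0\<^sup>2 = (1 - \<alpha>)b\<^sub>0\<close>. The first fact yields the sum and the second the
  difference of \<open>b\<^sub>0(b\<^sub>h x)\<close> and \<open>b\<^sub>h(b\<^sub>0 x)\<close>, where \<open>b\<^sub>h = b\<^sub>1\<^sub>/\<^sub>2\<close>; this gives (5)--(8).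

  Thirdly, the Miyamoto involution \<open>\<tau>\<close> of \<open>b\<close> is multiplicative, so \<open>\<tau>(a)\<tau>(x) = \<tau>(ax)\<close>. The odd part for
  \<open>x = x\<^sub>1\<^sub>/\<^sub>2\<close>, respectively the even part for \<open>x = x\<^sub>0\<close>, is a linear equation in \<open>b\<^sub>0(b\<^sub>0 x)\<close> and
  \<open>b\<^sub>h(b\<^sub>h x)\<close>, whose sum is known from the first fact. After elimination \<open>b\<^sub>0(b\<^sub>0 x)\<close> has coefficient
  \<open>8\<close> up to sign, which is invertible; this gives (1)--(4).
\<close>

section \<open>Bilinearity, and linear functionals as a test for equality\<close>

context frobenius_algebra
begin

lemma mul_add_right: "x \<cdot> (y + z) = x \<cdot> y + x \<cdot> z"
  using mul_linear[of x] by (simp add: Vector_Spaces.linear_iff)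

lemma mul_scale_right: "x \<cdot> (t *s y) = t *s (x \<cdot> y)"
  using mul_linear[of x] by (simp add: Vector_Spaces.linear_iff)

lemma mul_diff_right: "x \<cdot> (y - z) = x \<cdot> y - x \<cdot> z"
  by (metis add_diff_cancel diff_add_cancel mul_add_right)

lemma mul_add_left: "(y + z) \<cdot> x = y \<cdot> x + z \<cdot> x"
  by (metis mul_add_right mul_commute)

lemma mul_diff_left: "(y - z) \<cdot> x = y \<cdot> x - z \<cdot> x"
  by (metis mul_diff_right mul_commute)

lemma mul_scale_left: "(t *s y) \<cdot> x = t *s (y \<cdot> x)"
  by (metis mul_scale_right mul_commute)

lemma mul_zero_right: "x \<cdot> 0 = 0"
  by (metis diff_self mul_diff_right)

lemma mul_zero_left: "0 \<cdot> x = 0"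
  by (metis mul_zero_right mul_commute)

lemmas mul_simps = mul_add_right mul_add_left mul_diff_right mul_diff_left
  mul_scale_right mul_scale_left mul_zero_right mul_zero_left

lemma form_add_right: "form x (y + z) = form x y + form x z"
  using form_linear[of x] by (simp add: Vector_Spaces.linear_iff)

lemma form_scale_right: "form x (t *s y) = t * form x y"
  using form_linear[of x] by (simp add: Vector_Spaces.linear_iff)

lemma form_diff_right: "form x (y - z) = form x y - form x z"
  by (metis add_diff_cancel diff_add_cancel form_add_right)

lemma form_add_left: "form (y + z) x = form y x + form z x"
  by (metis form_add_right form_sym)

lemma form_diff_left: "form (y - z) x = form y x - form z x"
  by (metis form_diff_right form_sym)

lemma form_scale_left: "form (t *s y) x = t * form y x"
  by (metis form_scale_right form_sym)

lemma form_zero_right: "form x 0 = 0"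
  by (metis diff_self form_diff_right)

lemma form_zero_left: "form 0 x = 0"
  by (metis form_zero_right form_sym)

lemmas form_simps = form_add_right form_add_left form_diff_right form_diff_left
  form_scale_right form_scale_left form_zero_right form_zero_left

text \<open>Linear functionals separate points; this turns identities between vectors into identities
  in the field, which are decided by Groebner bases.\<close>

lemma eq_by_functionals:
  assumes "\<And>f :: 'a \<Rightarrow> 'f. \<lbrakk>\<And>x y. f (x + y) = f x + f y; \<And>x y. f (x - y) = f x - f y;
    \<And>t x. f (t *s x) = t * f x; f 0 = 0\<rbrakk> \<Longrightarrow> f u = f v"
  shows "u = v"
proof (rule ccontr)
  assume "u \<noteq> v"
  interpret vector_space_pair "(*s)" "(*) :: 'f \<Rightarrow> 'f \<Rightarrow> 'f"
    by unfold_locales (simp_all add: algebra_simps)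
  have "independent {u - v}"
    using \<open>u \<noteq> v\<close> by (simp add: independent_insert)
  then obtain f :: "'a \<Rightarrow> 'f" where f: "Vector_Spaces.linear (*s) (*) f" "f (u - v) = 1"
    using linear_independent_extend[of "{u - v}" "\<lambda>_. 1"] by auto
  have "f u = f v"
    by (rule assms) (use f(1) in \<open>simp_all add: linear_add linear_diff linear_scale linear_0\<close>)
  then show False
    using f by (simp add: linear_diff)
qed

end

section \<open>One axis: components, fusion and the Miyamoto involution\<close>

locale frobenius_axis = frobenius_algebra +
  fixes c :: 'b
  assumes two_neq_zero: "(2::'a) \<noteq> 0"
    and axis: "axis (*s) (\<cdot>) form c"
begin

text \<open>The eigenspaces of the Miyamoto involution of \<open>c\<close>: the first is \<open>\<F>c + A\<^sub>0(c)\<close>, the second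
  \<open>A\<^sub>1\<^sub>/\<^sub>2(c)\<close>.\<close>

definition in_plus :: "'b \<Rightarrow> bool"
  where "in_plus x \<longleftrightarrow> c \<cdot> x = form c x *s c"

definition in_minus :: "'b \<Rightarrow> bool"
  where "in_minus x \<longleftrightarrow> 2 *s (c \<cdot> x) = x"

text \<open>Multiplying \<open>x = (c,x)c + y + z\<close> by \<open>c\<close> gives
  \<open>(c,x)c + z/2\<close>; the formula solves this for \<open>z\<close>. Thus the projection
  onto \<open>A\<^sub>1\<^sub>/\<^sub>2(c)\<close> is linear by inspection and needs no definite
  description.\<close>

definition minus_part :: "'b \<Rightarrow> 'b"
  where "minus_part x = 2 *s (c \<cdot> x) - (2 * form c x) *s c"

definition miyamoto :: "'b \<Rightarrow> 'b"
  where "miyamoto x = x - 2 *s minus_part x"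

lemma in_eigenspace_half_iff: "x \<in> eigenspace (*s) (\<cdot>) c (1/2) \<longleftrightarrow> in_minus x"
proof -
  have "c \<cdot> x = (1/2) *s x \<longleftrightarrow> 2 *s (c \<cdot> x) = 2 *s (1/2) *s x"
    using two_neq_zero by (simp only: scale_left_imp_eq scale_cancel_left) simp
  then show ?thesis
    using two_neq_zero by (simp add: eigenspace_def in_minus_def)
qed

lemma in_eigenspace_zero_iff: "x \<in> eigenspace (*s) (\<cdot>) c 0 \<longleftrightarrow> c \<cdot> x = 0"
  by (simp add: eigenspace_def)

lemma fusion:
  "\<forall>x\<in>eigenspace (*s) (\<cdot>) c 0. \<forall>y\<in>eigenspace (*s) (\<cdot>) c 0. x \<cdot> y \<in> eigenspace (*s) (\<cdot>) c 0"
  "\<forall>x\<in>eigenspace (*s) (\<cdot>) c 0. \<forall>y\<in>eigenspace (*s) (\<cdot>) c (1/2).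
    x \<cdot> y \<in> eigenspace (*s) (\<cdot>) c (1/2)"
  "\<forall>x\<in>eigenspace (*s) (\<cdot>) c (1/2). \<forall>y\<in>eigenspace (*s) (\<cdot>) c (1/2).
    \<exists>u\<in>range (\<lambda>t. t *s c). \<exists>v\<in>eigenspace (*s) (\<cdot>) c 0. x \<cdot> y = u + v"
  using axis unfolding axis_def Let_def by - (elim conjE, assumption)+

lemma mul_self: "c \<cdot> c = c"
  and form_self: "form c c = 1"
  using axis by (simp_all add: axis_def Let_def)

lemma form_mul: "form c (c \<cdot> x) = form c x"
  by (metis form_assoc mul_self)

lemma form_eigenspace_zero: "c \<cdot> x = 0 \<Longrightarrow> form c x = 0"
  by (metis form_mul form_zero_right)

lemma form_in_minus:
  assumes "in_minus x"
  shows "form c x = 0"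
proof -
  have "2 * form c x = form c x"
    using assms form_mul[of x] form_scale_right[of c 2 "c \<cdot> x"] by (simp add: in_minus_def)
  then have "form c x + form c x = form c x + 0"
    by (simp only: mult_2 add_0_right)
  then show ?thesis
    by (rule add_left_imp_eq)
qed

text \<open>The axis is orthogonal to both eigenspaces, so pairing with \<open>c\<close> identifies
  the unknown coefficient of \<open>c\<close>.\<close>

lemma decomposition:
  obtains y z where "c \<cdot> y = 0" "in_minus z" "x = form c x *s c + y + z"
proof -
  have "\<exists>!(u, y, z). u \<in> range (\<lambda>t. t *s c) \<and> y \<in> eigenspace (*s) (\<cdot>) c 0 \<and>
      z \<in> eigenspace (*s) (\<cdot>) c (1/2) \<and> x = u + y + z"
    using axis by (simp add: axis_def Let_def)
  then obtain t y z where *: "c \<cdot> y = 0" "in_minus z" "x = t *s c + y + z"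
    unfolding in_eigenspace_zero_iff in_eigenspace_half_iff by auto
  then have "t = form c x"
    by (simp add: form_simps form_self form_eigenspace_zero form_in_minus)
  from *[unfolded this] show ?thesis
    by (rule that)
qed

lemma minus_part_decomposition:
  assumes "c \<cdot> y = 0" "in_minus z" "x = form c x *s c + y + z"
  shows "minus_part x = z"
proof -
  have "2 *s (c \<cdot> x) = 2 *s (form c x *s c + c \<cdot> z)"
    using assms(1) by (subst assms(3)) (simp add: mul_simps mul_self)
  then show ?thesis
    using assms(2) by (simp add: minus_part_def in_minus_def scale_right_distrib)
qed

lemma in_minus_minus_part: "in_minus (minus_part x)"
  by (metis decomposition minus_part_decomposition)

text \<open>Expanding \<open>in_minus (minus_part x)\<close> by the definition of
  \<open>minus_part\<close> yields twice this identity, and 2 may be cancelled.\<close>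

lemma mul_mul: "2 *s (c \<cdot> (c \<cdot> x)) = c \<cdot> x + form c x *s c"
proof (rule eq_by_functionals, goal_cases)
  case (1 f)
  have "2 * f (c \<cdot> minus_part x) = f (minus_part x)"
    using in_minus_minus_part[of x] 1(3) by (metis in_minus_def)
  then have "2 * (2 * f (c \<cdot> (c \<cdot> x)) - (f (c \<cdot> x) + form c x * f c)) = 0"
    by (simp add: minus_part_def mul_simps mul_self 1 algebra_simps)
  then have "2 * f (c \<cdot> (c \<cdot> x)) - (f (c \<cdot> x) + form c x * f c) = 0"
    using two_neq_zero mult_eq_0_iff by blast
  then show ?case
    by (simp add: 1)
qed

lemma in_plus_diff_minus_part: "in_plus (x - minus_part x)"
  unfolding in_plus_def
proof (rule eq_by_functionals, goal_cases)
  case (1 f)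
  have "2 * f (c \<cdot> (c \<cdot> x)) = f (c \<cdot> x) + form c x * f c"
    using arg_cong[OF mul_mul, of f x] by (simp add: 1)
  then show ?case
    by (simp add: minus_part_def mul_simps form_simps mul_self form_self form_mul 1)
qed

text \<open>Write \<open>e = (c,e)c + u\<close> with \<open>cu = 0\<close>. Multiplication by
  \<open>u\<close> kills \<open>c\<close> and, by fusion, preserves \<open>A\<^sub>0(c)\<close> and
  \<open>A\<^sub>1\<^sub>/\<^sub>2(c)\<close>, so it commutes with multiplication by
  \<open>c\<close> on each summand.\<close>

lemma seress:
  assumes "in_plus e"
  shows "c \<cdot> (e \<cdot> y) = e \<cdot> (c \<cdot> y)"
proof -
  define u where "u = e - form c e *s c"
  have e: "e = form c e *s c + u" and cu: "c \<cdot> u = 0"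
    using assms by (simp_all add: u_def in_plus_def mul_simps mul_self)
  have uc: "u \<cdot> c = 0"
    using cu by (metis mul_commute)
  obtain v z where v: "c \<cdot> v = 0" and z: "in_minus z" and y: "y = form c y *s c + v + z"
    using decomposition by blast
  have uv: "c \<cdot> (u \<cdot> v) = 0" and uz: "2 *s (c \<cdot> (u \<cdot> z)) = u \<cdot> z"
    using fusion(1,2) cu v z
    by (simp_all add: in_eigenspace_half_iff in_eigenspace_zero_iff in_minus_def)
  have "2 *s (c \<cdot> (u \<cdot> y)) = 2 *s (u \<cdot> (c \<cdot> y))"
  proof -
    have "2 *s (u \<cdot> (c \<cdot> y)) = u \<cdot> (2 *s (c \<cdot> z))"
      by (subst y) (simp add: mul_simps mul_self uc v)
    moreover have "2 *s (c \<cdot> (u \<cdot> y)) = 2 *s (c \<cdot> (u \<cdot> z))"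
      by (subst y) (simp add: mul_simps uc uv)
    ultimately show ?thesis
      using z uz by (simp add: in_minus_def)
  qed
  then have "c \<cdot> (u \<cdot> y) = u \<cdot> (c \<cdot> y)"
    using two_neq_zero by simp
  then show ?thesis
    by (subst (1 2) e) (simp add: mul_simps)
qed

lemma in_plus_add: "in_plus x \<Longrightarrow> in_plus y \<Longrightarrow> in_plus (x + y)"
  by (simp add: in_plus_def mul_simps form_simps scale_left_distrib)

lemma in_minus_add: "in_minus x \<Longrightarrow> in_minus y \<Longrightarrow> in_minus (x + y)"
  by (simp add: in_minus_def mul_simps scale_right_distrib)

lemma in_plus_scale: "in_plus x \<Longrightarrow> in_plus (t *s x)"
  by (simp add: in_plus_def mul_simps form_simps)

lemma in_plus_zero: "c \<cdot> x = 0 \<Longrightarrow> in_plus x"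
  by (simp add: in_plus_def form_eigenspace_zero)

lemma in_plus_self: "in_plus c"
  by (simp add: in_plus_def mul_self form_self)

text \<open>The Seress property gives \<open>c(xy) = x(cy) = (c,x)(c,y)c\<close>, and associativity
  of the form gives the same scalar for \<open>(c,xy)\<close>.\<close>

lemma in_plus_plus_mul_plus:
  assumes "in_plus x" "in_plus y"
  shows "in_plus (x \<cdot> y)"
proof -
  have "c \<cdot> (x \<cdot> y) = (form c y * form c x) *s c"
    using assms seress[of x y] mul_commute[of x c] by (simp add: in_plus_def mul_simps)
  moreover have "form c (x \<cdot> y) = form c x * form c y"
    using assms form_assoc[of c x y] by (simp add: in_plus_def form_simps)
  ultimately show ?thesis
    by (simp add: in_plus_def mult.commute)
qed

lemma in_minus_plus_mul_minus:
  assumes "in_plus x" "in_minus y"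
  shows "in_minus (x \<cdot> y)"
  using assms seress[of x y] mul_scale_right[of x 2 "c \<cdot> y"] by (simp add: in_minus_def)

lemma in_plus_minus_mul_minus:
  assumes "in_minus x" "in_minus y"
  shows "in_plus (x \<cdot> y)"
proof -
  have "\<exists>u\<in>range (\<lambda>t. t *s c). \<exists>v\<in>eigenspace (*s) (\<cdot>) c 0. x \<cdot> y = u + v"
    using fusion(3) assms by (simp add: in_eigenspace_half_iff)
  then obtain t v where "c \<cdot> v = 0" "x \<cdot> y = t *s c + v"
    by (blast dest: in_eigenspace_zero_iff[THEN iffD1])
  then show ?thesis
    by (simp add: in_plus_add in_plus_scale in_plus_self in_plus_zero)
qed

lemma minus_part_in_plus: "in_plus x \<Longrightarrow> minus_part x = 0"
  by (simp add: in_plus_def minus_part_def)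

lemma minus_part_in_minus: "in_minus x \<Longrightarrow> minus_part x = x"
  by (simp add: in_minus_def minus_part_def form_in_minus)

lemma minus_part_add: "minus_part (x + y) = minus_part x + minus_part y"
  by (simp add: minus_part_def mul_simps form_simps algebra_simps)

lemma minus_part_diff: "minus_part (x - y) = minus_part x - minus_part y"
  by (simp add: minus_part_def mul_simps form_simps algebra_simps)

lemma minus_part_scale: "minus_part (t *s x) = t *s minus_part x"
  by (simp add: minus_part_def mul_simps form_simps scale_right_diff_distrib mult.left_commute)

lemma minus_part_zero: "minus_part 0 = 0"
  by (simp add: minus_part_def mul_simps form_simps)

lemmas minus_part_simps = minus_part_add minus_part_diff minus_part_scale minus_part_zero

lemma miyamoto_plus_minus: "in_plus x \<Longrightarrow> in_minus y \<Longrightarrow> miyamoto (x + y) = x - y"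
  using scale_left_distrib[of 1 1 y]
  by (simp add: miyamoto_def minus_part_add minus_part_in_plus minus_part_in_minus)

text \<open>The fusion rules amount to a grading by a group of order 2, and changing the sign of the
  odd component respects such a grading.\<close>

lemma miyamoto_mul: "miyamoto (x \<cdot> y) = miyamoto x \<cdot> miyamoto y"
proof -
  define u v u' v' where
    "u = x - minus_part x" and "v = minus_part x" and "u' = y - minus_part y" and "v' = minus_part y"
  have x: "x = u + v" and y: "y = u' + v'"
    by (simp_all add: u_def v_def u'_def v'_def)
  have *: "in_plus u" "in_minus v" "in_plus u'" "in_minus v'"
    unfolding u_def v_def u'_def v'_def
    by (rule in_plus_diff_minus_part in_minus_minus_part)+
  have "miyamoto (x \<cdot> y) = miyamoto ((u \<cdot> u' + v \<cdot> v') + (u \<cdot> v' + u' \<cdot> v))"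
    by (simp add: x y mul_simps mul_commute[of u' v] ac_simps)
  also have "\<dots> = (u \<cdot> u' + v \<cdot> v') - (u \<cdot> v' + u' \<cdot> v)"
    using * by (intro miyamoto_plus_minus in_plus_add in_minus_add in_plus_plus_mul_plus
        in_plus_minus_mul_minus in_minus_plus_mul_minus)
  also have "\<dots> = miyamoto x \<cdot> miyamoto y"
    using * by (simp add: x y miyamoto_plus_minus mul_simps mul_commute[of u' v] algebra_simps)
  finally show ?thesis .
qed

text \<open>The element below is symmetric in \<open>c\<close> and \<open>x\<close>, so for two axes it lies in \<open>\<F>c + A\<^sub>0(c)\<close> for both.\<close>

lemma in_plus_sigma: "in_plus (c + x - 2 *s (c \<cdot> x))"
  unfolding in_plus_def
proof (rule eq_by_functionals, goal_cases)
  case (1 f)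
  show ?case
    by (simp add: mul_simps form_simps mul_self form_self form_mul mul_mul 1 algebra_simps)
qed

text \<open>By \<open>minus_part_decomposition\<close> a competing decomposition has the same
  component \<open>z\<close>, hence the same \<open>y\<close>; this is the uniqueness needed for
  \<open>THE\<close>.\<close>

lemma zero_part_eq:
  assumes "c \<cdot> y = 0" "in_minus z" "x = form c x *s c + y + z"
  shows "zero_part (*s) (\<cdot>) form c x = y"
  unfolding zero_part_def in_eigenspace_zero_iff in_eigenspace_half_iff Bex_def
  using assms minus_part_decomposition[of _ _ x]
  by (intro the_equality) (blast, metis add_diff_cancel_left' add_diff_cancel_right')

lemma half_part_eq:
  assumes "c \<cdot> y = 0" "in_minus z" "x = form c x *s c + y + z"
  shows "half_part (*s) (\<cdot>) form c x = z"
  unfolding half_part_def in_eigenspace_zero_iff in_eigenspace_half_iff Bex_def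
  using assms minus_part_decomposition[of _ _ x]
  by (intro the_equality) (blast, metis)

end

section \<open>Two axes: products among the components of \<open>b\<close>\<close>

locale axis_pair = frobenius_algebra +
  fixes a b b0 bh :: 'b and h :: 'a
  assumes two_h: "2 * h = 1"
    and axis_a: "axis (*s) (\<cdot>) form a"
    and axis_b: "axis (*s) (\<cdot>) form b"
    and a_b0: "a \<cdot> b0 = 0"
    and a_bh: "a \<cdot> bh = h *s bh"
    and b_eq: "b = form a b *s a + b0 + bh"
begin

abbreviation \<alpha> :: 'a
  where "\<alpha> \<equiv> form a b"

lemma two_neq_zero: "(2::'a) \<noteq> 0"
  using two_h by auto

text \<open>In positive characteristic the method \<open>algebra\<close> only finds certificates with integer
  coefficients; the factor 16 clears the denominators that would arise from solving for \<open>h\<close>.\<close>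

lemma eq_by_scaled_functionals:
  assumes "\<And>f :: 'b \<Rightarrow> 'a. \<lbrakk>\<And>x y. f (x + y) = f x + f y; \<And>x y. f (x - y) = f x - f y;
    \<And>t x. f (t *s x) = t * f x; f 0 = 0\<rbrakk> \<Longrightarrow> 16 * f u = 16 * f v"
  shows "u = v"
proof -
  have "(16::'a) \<noteq> 0"
    using power_not_zero[OF two_neq_zero, of 4] by simp
  with assms show ?thesis
    by (intro eq_by_functionals) simp
qed

sublocale A: frobenius_axis scale mul form a
  by unfold_locales (fact two_neq_zero axis_a)+

sublocale B: frobenius_axis scale mul form b
  by unfold_locales (fact two_neq_zero axis_b)+

text \<open>The parameter \<open>h\<close> plays the role of 1/2 but enters only through
  \<open>2 * h = 1\<close>, which keeps the calculations polynomial.\<close>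

lemma in_minus_iff: "A.in_minus x \<longleftrightarrow> a \<cdot> x = h *s x"
proof -
  have "a \<cdot> x = h *s x \<longleftrightarrow> 2 *s (a \<cdot> x) = 2 *s h *s x"
    using two_neq_zero by (simp only: scale_cancel_left) simp
  then show ?thesis
    by (simp add: A.in_minus_def two_h)
qed

lemma in_plus_b0: "A.in_plus b0"
  using A.in_plus_zero a_b0 by blast

lemma in_minus_bh: "A.in_minus bh"
  using a_bh in_minus_iff by blast

lemma b_mul: "b \<cdot> x = \<alpha> *s (a \<cdot> x) + b0 \<cdot> x + bh \<cdot> x"
  by (subst b_eq) (simp add: mul_simps)

lemma bh_a: "bh \<cdot> a = h *s bh" and b0_a: "b0 \<cdot> a = 0"
  by (metis a_bh a_b0 mul_commute)+

lemmas atom_simps = A.mul_self A.form_self a_b0 a_bh bh_a b0_a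

lemma b_b_expanded:
  "(\<alpha> * \<alpha>) *s a + b0 \<cdot> b0 + bh \<cdot> bh + ((2 * \<alpha> * h) *s bh + 2 *s (b0 \<cdot> bh))
    = \<alpha> *s a + b0 + bh"
proof -
  have "(\<alpha> * \<alpha>) *s a + b0 \<cdot> b0 + bh \<cdot> bh + ((2 * \<alpha> * h) *s bh + 2 *s (b0 \<cdot> bh)) = b \<cdot> b"
    \<comment> \<open>The first three occurrences of \<open>b\<close> are inside the abbreviation
      \<alpha>; only the two factors of the product are rewritten.\<close>
    by (subst (4 5) b_eq, simp add: mul_simps atom_simps mul_commute[of bh b0])
      (rule eq_by_functionals, simp add: algebra_simps)
  then show ?thesis
    using B.mul_self b_eq by simp
qed

text \<open>This is the odd part of \<open>b \<cdot> b = b\<close>.\<close>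

lemma b0_bh: "b0 \<cdot> bh = (h * (1 - \<alpha>)) *s bh"
proof -
  have [simp]: "A.minus_part (b0 \<cdot> bh) = b0 \<cdot> bh" "A.minus_part (b0 \<cdot> b0) = 0"
    "A.minus_part (bh \<cdot> bh) = 0" "A.minus_part b0 = 0" "A.minus_part bh = bh" "A.minus_part a = 0"
    using in_plus_b0 in_minus_bh
    by (simp_all add: A.minus_part_in_plus A.minus_part_in_minus A.in_plus_plus_mul_plus
        A.in_plus_minus_mul_minus A.in_minus_plus_mul_minus A.in_plus_self)
  have "(2 * \<alpha> * h) *s bh + 2 *s (b0 \<cdot> bh) = bh"
    using arg_cong[OF b_b_expanded, of A.minus_part] by (simp add: A.minus_part_simps)
  note * = this
  show ?thesis
  proof (rule eq_by_scaled_functionals)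
    fix f assume f: "\<And>x y. f (x + y) = f x + f y" "\<And>t x. f (t *s x) = t * f x"
    have "2 * \<alpha> * h * f bh + 2 * f (b0 \<cdot> bh) = f bh"
      using arg_cong[OF *, of f] by (simp add: f)
    with two_h show "16 * f (b0 \<cdot> bh) = 16 * f ((h * (1 - \<alpha>)) *s bh)"
      unfolding f by algebra
  qed
qed

text \<open>The half-component cancels because \<open>ba\<close> is \<alpha> times \<open>a\<close>
  plus \<open>h\<close> times \<open>bh\<close>. This expresses the element from
  \<open>B.in_plus_sigma\<close> in components for \<open>a\<close>.\<close>

lemma sigma_eq: "b + a - 2 *s (b \<cdot> a) = (1 - \<alpha>) *s a + b0"
proof (rule eq_by_scaled_functionals)
  fix f assume f: "\<And>x y. f (x + y) = f x + f y" "\<And>x y. f (x - y) = f x - f y"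
    "\<And>t x. f (t *s x) = t * f x"
  have "f (b \<cdot> a) = \<alpha> * f a + h * f bh"
    by (simp add: b_mul atom_simps f mul_zero_right)
  moreover have "f b = \<alpha> * f a + f b0 + f bh"
    using arg_cong[OF b_eq, of f] by (simp add: f)
  ultimately show "16 * f (b + a - 2 *s (b \<cdot> a)) = 16 * f ((1 - \<alpha>) *s a + b0)"
    using two_h unfolding f by algebra
qed

lemma in_plus_sigma: "B.in_plus ((1 - \<alpha>) *s a + b0)"
  using B.in_plus_sigma[of a] by (simp add: sigma_eq)

lemma form_sigma: "form b ((1 - \<alpha>) *s a + b0) = 1 - \<alpha>"
  by (simp only: sigma_eq[symmetric] form_simps B.form_self B.form_mul form_sym[of b a])
    (simp add: algebra_simps)

text \<open>The element of \<open>in_plus_sigma\<close> is multiplied by \<open>b\<close> to its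
  form value with \<open>b\<close>, times \<open>b\<close>. In the expansion only
  \<open>b0 \<cdot> b0\<close> is not yet known.\<close>

lemma b0_b0: "b0 \<cdot> b0 = (1 - \<alpha>) *s b0"
proof (rule eq_by_scaled_functionals)
  fix f assume f: "\<And>x y. f (x + y) = f x + f y" "\<And>x y. f (x - y) = f x - f y"
    "\<And>t x. f (t *s x) = t * f x"
  have "b \<cdot> ((1 - \<alpha>) *s a + b0) = (1 - \<alpha>) *s b"
    using in_plus_sigma by (simp add: B.in_plus_def form_sigma)
  then have "f (b \<cdot> ((1 - \<alpha>) *s a + b0)) = (1 - \<alpha>) * f b"
    by (simp add: f)
  moreover have "f b = \<alpha> * f a + f b0 + f bh"
    using arg_cong[OF b_eq, of f] by (simp add: f)
  moreover have "f (b \<cdot> ((1 - \<alpha>) *s a + b0)) =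
      (1 - \<alpha>) * (\<alpha> * f a + h * f bh) + f (b0 \<cdot> b0) + h * (1 - \<alpha>) * f bh"
    by (simp add: b_mul mul_simps atom_simps f mul_commute[of bh b0] b0_bh)
  ultimately show "16 * f (b0 \<cdot> b0) = 16 * f ((1 - \<alpha>) *s b0)"
    using two_h unfolding f by algebra
qed

text \<open>The last unknown product in \<open>b \<cdot> b = b\<close>.\<close>

lemma bh_bh: "bh \<cdot> bh = (\<alpha> * (1 - \<alpha>)) *s a + \<alpha> *s b0"
proof (rule eq_by_scaled_functionals)
  fix f assume f: "\<And>x y. f (x + y) = f x + f y" "\<And>x y. f (x - y) = f x - f y"
    "\<And>t x. f (t *s x) = t * f x"
  have "f (bh \<cdot> bh) + \<alpha> * \<alpha> * f a + (1 - \<alpha>) * f b0 + 2 * \<alpha> * h * f bh + 2 * h * (1 - \<alpha>) * f bh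
     = \<alpha> * f a + f b0 + f bh"
    using arg_cong[OF b_b_expanded, of f] by (simp add: f b0_b0 b0_bh algebra_simps)
  then show "16 * f (bh \<cdot> bh) = 16 * f ((\<alpha> * (1 - \<alpha>)) *s a + \<alpha> *s b0)"
    using two_h unfolding f by algebra
qed

lemma sigma_commute: "b \<cdot> (((1 - \<alpha>) *s a + b0) \<cdot> x) = ((1 - \<alpha>) *s a + b0) \<cdot> (b \<cdot> x)"
  by (rule B.seress[OF in_plus_sigma])

lemma miyamoto_a: "B.miyamoto a = ((1 - 2 * \<alpha>) * (1 - 2 * \<alpha>)) *s a + (4 * \<alpha>) *s b0 + (4 * \<alpha> - 2) *s bh"
proof (rule eq_by_scaled_functionals)
  fix f assume f: "\<And>x y. f (x + y) = f x + f y" "\<And>x y. f (x - y) = f x - f y"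
    "\<And>t x. f (t *s x) = t * f x"
  have "f (b \<cdot> a) = \<alpha> * f a + h * f bh"
    by (simp add: b_mul atom_simps f mul_zero_right)
  moreover have "f b = \<alpha> * f a + f b0 + f bh"
    using arg_cong[OF b_eq, of f] by (simp add: f)
  ultimately show "16 * f (B.miyamoto a) =
     16 * f (((1 - 2 * \<alpha>) * (1 - 2 * \<alpha>)) *s a + (4 * \<alpha>) *s b0 + (4 * \<alpha> - 2) *s bh)"
    using two_h unfolding B.miyamoto_def B.minus_part_def f form_sym[of b a] by algebra
qed

section \<open>Multiplication by \<open>b0\<close> and \<open>bh\<close> on
  \<open>A\<^sub>1\<^sub>/\<^sub>2(a)\<close>\<close>

context
  fixes x
  assumes a_x: "a \<cdot> x = h *s x"
begin

text \<open>Associativity of the form makes distinct eigenspaces of \<open>a\<close> orthogonal, so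
  \<open>a\<close> and \<open>b0\<close> contribute nothing.\<close>

lemma form_bh_minus: "form bh x = form b x"
proof -
  have "h * form b0 x = form (b0 \<cdot> a) x"
    by (simp add: form_assoc a_x form_simps)
  then have "form b0 x = 0"
    using two_h by (auto simp: b0_a form_simps)
  then show ?thesis
    using A.form_in_minus[of x] a_x in_minus_iff
    by (subst b_eq) (simp add: form_simps)
qed

lemma a_b0_minus: "a \<cdot> (b0 \<cdot> x) = h *s (b0 \<cdot> x)"
  using A.in_minus_plus_mul_minus[OF in_plus_b0, of x] by (simp add: in_minus_iff a_x)

lemma form_bh_mul_minus: "form a (bh \<cdot> x) = h * form b x"
  using form_assoc[of a bh x] by (simp add: a_bh form_simps form_bh_minus)

lemma in_plus_bh_minus: "A.in_plus (bh \<cdot> x)"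
  using A.in_plus_minus_mul_minus[OF in_minus_bh, of x] by (simp add: in_minus_iff a_x)

lemma a_bh_minus: "a \<cdot> (bh \<cdot> x) = (h * form b x) *s a"
  using in_plus_bh_minus by (simp add: A.in_plus_def form_bh_mul_minus)

text \<open>With these values, applying \<open>A.minus_part\<close> to an identity extracts its odd
  part.\<close>

lemma minus_part_atoms:
  "A.minus_part a = 0" "A.minus_part b0 = 0" "A.minus_part bh = bh" "A.minus_part x = x"
  "A.minus_part (b0 \<cdot> x) = b0 \<cdot> x" "A.minus_part (bh \<cdot> x) = 0"
  "A.minus_part (b0 \<cdot> (b0 \<cdot> x)) = b0 \<cdot> (b0 \<cdot> x)" "A.minus_part (bh \<cdot> (b0 \<cdot> x)) = 0"
  "A.minus_part (b0 \<cdot> (bh \<cdot> x)) = 0" "A.minus_part (bh \<cdot> (bh \<cdot> x)) = bh \<cdot> (bh \<cdot> x)"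
proof -
  have *: "A.in_minus x" "A.in_minus (b0 \<cdot> x)" "A.in_plus (bh \<cdot> x)"
    using a_x a_b0_minus in_plus_bh_minus by (simp_all add: in_minus_iff)
  then have "A.in_minus (bh \<cdot> (bh \<cdot> x))"
    using A.in_minus_plus_mul_minus[OF *(3) in_minus_bh] by (simp add: mul_commute)
  with * show 
    "A.minus_part a = 0" "A.minus_part b0 = 0" "A.minus_part bh = bh" "A.minus_part x = x"
    "A.minus_part (b0 \<cdot> x) = b0 \<cdot> x" "A.minus_part (bh \<cdot> x) = 0"
    "A.minus_part (b0 \<cdot> (b0 \<cdot> x)) = b0 \<cdot> (b0 \<cdot> x)" "A.minus_part (bh \<cdot> (b0 \<cdot> x)) = 0"
    "A.minus_part (b0 \<cdot> (bh \<cdot> x)) = 0" "A.minus_part (bh \<cdot> (bh \<cdot> x)) = bh \<cdot> (bh \<cdot> x)"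
    using in_plus_b0 in_minus_bh
    by (simp_all add: A.minus_part_in_plus A.minus_part_in_minus A.in_plus_plus_mul_plus
        A.in_plus_minus_mul_minus A.in_minus_plus_mul_minus A.in_plus_self)
qed

lemma b_minus: "b \<cdot> x = (\<alpha> * h) *s x + b0 \<cdot> x + bh \<cdot> x"
  by (simp add: b_mul a_x)

lemma b_b_minus_expanded:
  "2 *s ((\<alpha> * h * (\<alpha> * h)) *s x + (2 * \<alpha> * h) *s (b0 \<cdot> x) + (\<alpha> * h) *s (bh \<cdot> x)
      + b0 \<cdot> (b0 \<cdot> x) + bh \<cdot> (b0 \<cdot> x) + (\<alpha> * h * form b x) *s a + b0 \<cdot> (bh \<cdot> x) + bh \<cdot> (bh \<cdot> x))
    = (\<alpha> * h) *s x + b0 \<cdot> x + bh \<cdot> x + form b x *s (\<alpha> *s a + b0 + bh)"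
proof (rule eq_by_functionals, goal_cases)
  case (1 f)
  have "f (b \<cdot> (b \<cdot> x)) = f ((\<alpha> * h * (\<alpha> * h)) *s x + (2 * \<alpha> * h) *s (b0 \<cdot> x)
      + (\<alpha> * h) *s (bh \<cdot> x) + b0 \<cdot> (b0 \<cdot> x) + bh \<cdot> (b0 \<cdot> x) + (\<alpha> * h * form b x) *s a
      + b0 \<cdot> (bh \<cdot> x) + bh \<cdot> (bh \<cdot> x))"
    by (simp add: b_minus mul_simps b_mul[of "b0 \<cdot> x"] b_mul[of "bh \<cdot> x"] a_b0_minus a_bh_minus 1 algebra_simps)
  moreover have "2 * f (b \<cdot> (b \<cdot> x)) = f (b \<cdot> x) + form b x * f b"
    using arg_cong[OF B.mul_mul, of f x] by (simp add: 1)
  moreover have "f b = \<alpha> * f a + f b0 + f bh"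
    using arg_cong[OF b_eq, of f] by (simp add: 1)
  ultimately show ?case
    by (simp add: 1 b_minus)
qed

lemma b_b_minus_odd:
  "2 *s ((\<alpha> * h * (\<alpha> * h)) *s x + (2 * \<alpha> * h) *s (b0 \<cdot> x)
      + b0 \<cdot> (b0 \<cdot> x) + bh \<cdot> (bh \<cdot> x))
    = (\<alpha> * h) *s x + b0 \<cdot> x + form b x *s bh"
  using arg_cong[OF b_b_minus_expanded, of A.minus_part]
  by (simp add: A.minus_part_simps minus_part_atoms)

lemma sigma_commute_minus:
  "(h * (1 - \<alpha>)) *s (bh \<cdot> x) + bh \<cdot> (b0 \<cdot> x) = (h * (1 - \<alpha>) * form b x) *s a + b0 \<cdot> (bh \<cdot> x)"
proof (rule eq_by_functionals, goal_cases)
  case (1 f)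
  note * = arg_cong[OF sigma_commute, of f x]
  show ?case
    using *
    by (simp add: b_minus mul_simps b_mul[of "b0 \<cdot> x"] a_x a_b0_minus a_bh_minus 1 algebra_simps)
qed

text \<open>Removing \<open>b_b_minus_odd\<close> from \<open>b_b_minus_expanded\<close> leaves the
  even part, hence the sum of the two mixed products; \<open>sigma_commute_minus\<close> is their
  difference.\<close>

lemma b0_bh_minus:
  "b0 \<cdot> (bh \<cdot> x) = (h * (1 - \<alpha>)) *s (bh \<cdot> x - (h * form b x) *s a) + (h * h * form b x) *s b0"
proof (rule eq_by_scaled_functionals, goal_cases)
  case (1 f)
  show ?case
    using arg_cong[OF b_b_minus_expanded, of f] arg_cong[OF b_b_minus_odd, of f]
      arg_cong[OF sigma_commute_minus, of f] two_h
    unfolding 1 by algebra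
qed

lemma bh_b0_minus:
  "bh \<cdot> (b0 \<cdot> x) = (h * h * (1 - \<alpha>) * form b x) *s a + (h * h * form b x) *s b0"
proof (rule eq_by_scaled_functionals, goal_cases)
  case (1 f)
  show ?case
    using arg_cong[OF b0_bh_minus, of f] arg_cong[OF sigma_commute_minus, of f] two_h
    unfolding 1 by algebra
qed

lemma miyamoto_minus: "B.miyamoto x = (1 - 4 * \<alpha> * h) *s x - 4 *s (b0 \<cdot> x) - 4 *s (bh \<cdot> x)
    + (4 * form b x) *s (\<alpha> *s a + b0 + bh)"
proof (rule eq_by_functionals, goal_cases)
  case (1 f)
  have "f b = \<alpha> * f a + f b0 + f bh"
    using arg_cong[OF b_eq, of f] by (simp add: 1)
  then show ?case
    by (simp add: 1 B.miyamoto_def B.minus_part_def b_minus algebra_simps)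
qed

lemma b0_b0_minus: "b0 \<cdot> (b0 \<cdot> x) = (h * (1 - \<alpha>)) *s (b0 \<cdot> x)"
proof -
  \<comment> \<open>The involution is linear and multiplicative, so it carries the eigenvector
    equation for \<open>x\<close> to the images.\<close>
  have "B.miyamoto a \<cdot> B.miyamoto x = h *s B.miyamoto x"
    using a_x by (simp add: B.miyamoto_mul[symmetric])
      (simp add: B.miyamoto_def B.minus_part_simps scale_right_diff_distrib mult.commute)
  note * = arg_cong[OF this, of A.minus_part]
  show ?thesis
  proof (rule eq_by_scaled_functionals, goal_cases)
    case (1 f)
    note ** = arg_cong[OF *, of f]
    \<comment> \<open>Here \<open>b0 \<cdot> (b0 \<cdot> x)\<close> and
      \<open>bh \<cdot> (bh \<cdot> x)\<close> have coefficients -16\<alpha> and 8 - 16\<alpha>.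
      Eliminating the second leaves -8, so no value of \<alpha> is exceptional.\<close>
    show ?case
      using ** arg_cong[OF b_b_minus_odd, of f] two_h
      apply (simp add: miyamoto_a miyamoto_minus mul_simps A.minus_part_simps minus_part_atoms 
         atom_simps a_x a_b0_minus a_bh_minus b0_b0 b0_bh bh_bh mul_commute[of bh b0] 1)
      apply algebra
      done
  qed
qed

lemma bh_bh_minus:
  "bh \<cdot> (bh \<cdot> x) = (h * h * \<alpha> * (1 - \<alpha>)) *s x - (h * \<alpha>) *s (b0 \<cdot> x) + (h * form b x) *s bh"
proof (rule eq_by_scaled_functionals, goal_cases)
  case (1 f)
  show ?case
    using arg_cong[OF b_b_minus_odd, of f] arg_cong[OF b0_b0_minus, of f] two_h
    unfolding 1 by algebra
qed

lemma zero_part_minus: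
  "zero_part (*s) (\<cdot>) form a (bh \<cdot> x) = bh \<cdot> x - (h * form b x) *s a"
  by (rule A.zero_part_eq[where z = 0])
    (simp_all add: A.in_minus_def mul_simps a_bh_minus A.mul_self form_bh_mul_minus)

text \<open>Dropping the multiple of \<open>a\<close> from \<open>bh \<cdot> x\<close> lowers the
  coefficient of \<open>bh\<close> from \<open>h * form b x\<close> to
  \<open>h * h * form b x\<close>, as \<open>h - h * h = h * h\<close>.\<close>

lemma zero_part_mul_bh_minus:
  "zero_part (*s) (\<cdot>) form a (bh \<cdot> x) \<cdot> bh
    = (h * h * \<alpha> * (1 - \<alpha>)) *s x - (h * \<alpha>) *s (b0 \<cdot> x) + (h * h * form b x) *s bh"
proof (rule eq_by_scaled_functionals, goal_cases)
  case (1 f)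
  have "f (zero_part (*s) (\<cdot>) form a (bh \<cdot> x) \<cdot> bh) = f (bh \<cdot> (bh \<cdot> x)) - h * form b x * h * f bh"
    by (simp add: zero_part_minus mul_simps a_bh mul_commute[of "bh \<cdot> x"] 1 mult.assoc)
  with arg_cong[OF bh_bh_minus, of f] two_h show ?case
    unfolding 1 by algebra
qed

end

section \<open>Multiplication by \<open>b0\<close> and \<open>bh\<close> on
  \<open>A\<^sub>0(a)\<close>\<close>

context
  fixes x
  assumes a_x: "a \<cdot> x = 0"
begin

lemma a_b0_plus: "a \<cdot> (b0 \<cdot> x) = 0"
  using A.seress[OF in_plus_b0, of x] by (simp add: a_x mul_simps)

lemma in_minus_bh_plus: "A.in_minus (bh \<cdot> x)"
  using A.in_minus_plus_mul_minus[OF A.in_plus_zero[OF a_x] in_minus_bh] by (simp add: mul_commute)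

lemma a_bh_plus: "a \<cdot> (bh \<cdot> x) = h *s (bh \<cdot> x)"
  using in_minus_bh_plus in_minus_iff by blast

lemma minus_part_atoms_plus:
  "A.minus_part a = 0" "A.minus_part b0 = 0" "A.minus_part bh = bh" "A.minus_part x = 0"
  "A.minus_part (b0 \<cdot> x) = 0" "A.minus_part (bh \<cdot> x) = bh \<cdot> x"
  "A.minus_part (b0 \<cdot> (b0 \<cdot> x)) = 0" "A.minus_part (bh \<cdot> (b0 \<cdot> x)) = bh \<cdot> (b0 \<cdot> x)"
  "A.minus_part (b0 \<cdot> (bh \<cdot> x)) = b0 \<cdot> (bh \<cdot> x)" "A.minus_part (bh \<cdot> (bh \<cdot> x)) = 0"
proof -
  have *: "A.in_plus x" "A.in_plus (b0 \<cdot> x)" "A.in_minus (bh \<cdot> x)"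
    using a_x a_b0_plus in_minus_bh_plus by (simp_all add: A.in_plus_zero)
  then have "A.in_minus (bh \<cdot> (b0 \<cdot> x))"
    using A.in_minus_plus_mul_minus[OF *(2) in_minus_bh] by (simp add: mul_commute)
  with * show
    "A.minus_part a = 0" "A.minus_part b0 = 0" "A.minus_part bh = bh" "A.minus_part x = 0"
    "A.minus_part (b0 \<cdot> x) = 0" "A.minus_part (bh \<cdot> x) = bh \<cdot> x"
    "A.minus_part (b0 \<cdot> (b0 \<cdot> x)) = 0" "A.minus_part (bh \<cdot> (b0 \<cdot> x)) = bh \<cdot> (b0 \<cdot> x)"
    "A.minus_part (b0 \<cdot> (bh \<cdot> x)) = b0 \<cdot> (bh \<cdot> x)" "A.minus_part (bh \<cdot> (bh \<cdot> x)) = 0"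
    using in_plus_b0 in_minus_bh
    by (simp_all add: A.minus_part_in_plus A.minus_part_in_minus A.in_plus_plus_mul_plus
        A.in_plus_minus_mul_minus A.in_minus_plus_mul_minus A.in_plus_self)
qed

lemma b_plus: "b \<cdot> x = b0 \<cdot> x + bh \<cdot> x"
  by (simp add: b_mul a_x)

lemma b_b_plus_expanded:
  "2 *s (b0 \<cdot> (b0 \<cdot> x) + bh \<cdot> (b0 \<cdot> x) + (\<alpha> * h) *s (bh \<cdot> x) + b0 \<cdot> (bh \<cdot> x) + bh \<cdot> (bh \<cdot> x))
    = b0 \<cdot> x + bh \<cdot> x + form b x *s (\<alpha> *s a + b0 + bh)"
proof (rule eq_by_functionals, goal_cases)
  case (1 f)
  have "f (b \<cdot> (b \<cdot> x)) = f (b0 \<cdot> (b0 \<cdot> x) + bh \<cdot> (b0 \<cdot> x) + (\<alpha> * h) *s (bh \<cdot> x)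
      + b0 \<cdot> (bh \<cdot> x) + bh \<cdot> (bh \<cdot> x))"
    by (simp add: b_plus mul_simps b_mul[of "b0 \<cdot> x"] b_mul[of "bh \<cdot> x"] a_b0_plus a_bh_plus 1
        algebra_simps)
  moreover have "2 * f (b \<cdot> (b \<cdot> x)) = f (b \<cdot> x) + form b x * f b"
    using arg_cong[OF B.mul_mul, of f x] by (simp add: 1)
  moreover have "f b = \<alpha> * f a + f b0 + f bh"
    using arg_cong[OF b_eq, of f] by (simp add: 1)
  ultimately show ?case
    by (simp add: 1 b_plus)
qed

lemma b_b_plus_odd:
  "2 *s (bh \<cdot> (b0 \<cdot> x) + (\<alpha> * h) *s (bh \<cdot> x) + b0 \<cdot> (bh \<cdot> x)) = bh \<cdot> x + form b x *s bh"
  using arg_cong[OF b_b_plus_expanded, of A.minus_part]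
  by (simp add: A.minus_part_simps minus_part_atoms_plus)

lemma sigma_commute_plus:
  "bh \<cdot> (b0 \<cdot> x) = (h * (1 - \<alpha>)) *s (bh \<cdot> x) + b0 \<cdot> (bh \<cdot> x)"
proof (rule eq_by_functionals, goal_cases)
  case (1 f)
  note * = arg_cong[OF sigma_commute, of f x]
  show ?case
    using *
    by (simp add: b_plus mul_simps b_mul[of "b0 \<cdot> x"] a_x a_b0_plus a_bh_plus 1 algebra_simps)
qed

text \<open>The mixed products are now odd: \<open>b_b_plus_odd\<close> gives their sum and
  \<open>sigma_commute_plus\<close> their difference.\<close>

lemma b0_bh_plus: "b0 \<cdot> (bh \<cdot> x) = (h * h * form b x) *s bh"
proof (rule eq_by_scaled_functionals, goal_cases)
  case (1 f)
  show ?case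
    using arg_cong[OF b_b_plus_odd, of f] arg_cong[OF sigma_commute_plus, of f] two_h
    unfolding 1 by algebra
qed

lemma bh_b0_plus: "bh \<cdot> (b0 \<cdot> x) = (h * (1 - \<alpha>)) *s (bh \<cdot> x) + (h * h * form b x) *s bh"
  using sigma_commute_plus by (simp add: b0_bh_plus)

lemma miyamoto_plus: "B.miyamoto x = x - 4 *s (b0 \<cdot> x) - 4 *s (bh \<cdot> x)
    + (4 * form b x) *s (\<alpha> *s a + b0 + bh)"
proof (rule eq_by_functionals, goal_cases)
  case (1 f)
  have "f b = \<alpha> * f a + f b0 + f bh"
    using arg_cong[OF b_eq, of f] by (simp add: 1)
  then show ?case
    by (simp add: 1 B.miyamoto_def B.minus_part_def b_plus algebra_simps)
qed

lemma b0_b0_plus: "b0 \<cdot> (b0 \<cdot> x) = (h * (1 - \<alpha>)) *s (b0 \<cdot> x) + (h * form b x) *s b0"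
proof -
  have miyamoto_eq: "B.miyamoto a \<cdot> B.miyamoto x = 0"
    using a_x by (simp add: B.miyamoto_mul[symmetric])
      (simp add: B.miyamoto_def B.minus_part_def mul_simps form_simps)
  show ?thesis
  proof (rule eq_by_scaled_functionals, goal_cases)
    case (1 f)
    \<comment> \<open>Both identities are supplied in full and in odd part, so their differences are
      the even parts; the coefficients are again -16\<alpha> and 8 - 16\<alpha>.\<close>
    show ?case
      using arg_cong[OF miyamoto_eq, of f] arg_cong[OF arg_cong[OF miyamoto_eq, of A.minus_part], of f]
        arg_cong[OF b_b_plus_expanded, of f] arg_cong[OF b_b_plus_odd, of f] two_h
      apply (simp add: miyamoto_a miyamoto_plus mul_simps A.minus_part_simps minus_part_atoms_plus
         atom_simps a_x a_b0_plus a_bh_plus b0_b0 b0_bh bh_bh mul_commute[of bh b0] 1)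
      apply algebra
      done
  qed
qed

lemma bh_bh_plus:
  "bh \<cdot> (bh \<cdot> x) = (h * \<alpha> * form b x) *s a + (h * \<alpha>) *s (b0 \<cdot> x)"
proof (rule eq_by_scaled_functionals, goal_cases)
  case (1 f)
  show ?case
    using arg_cong[OF b_b_plus_expanded, of f] arg_cong[OF b_b_plus_odd, of f]
      arg_cong[OF b0_b0_plus, of f] two_h
    unfolding 1 by algebra
qed

end

end

theorem theorem1p4:
  fixes scale :: "'f::field \<Rightarrow> 'a::ab_group_add \<Rightarrow> 'a" (infixr \<open>*s\<close> 75)
    and mul :: "'a \<Rightarrow> 'a \<Rightarrow> 'a" (infixl \<open>\<cdot>\<close> 70)
    and form :: "'a \<Rightarrow> 'a \<Rightarrow> 'f"
    and a b b0 bh x0 xh :: 'a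
  assumes "CHAR('f) \<noteq> 2"
    and "frobenius_algebra (*s) (\<cdot>) form"
    and "axis (*s) (\<cdot>) form a"
    and "axis (*s) (\<cdot>) form b"
    and "b0 = zero_part (*s) (\<cdot>) form a b"
    and "bh = half_part (*s) (\<cdot>) form a b"
    and "x0 \<in> eigenspace (*s) (\<cdot>) a 0"
    and "xh \<in> eigenspace (*s) (\<cdot>) a (1/2)"
  shows "(xh \<cdot> b0) \<cdot> b0 = (1/2 * (1 - form a b)) *s (xh \<cdot> b0) \<and>
         (x0 \<cdot> b0) \<cdot> b0 = (1/2 * (1 - form a b)) *s (x0 \<cdot> b0) + (1/2 * form b x0) *s b0 \<and>
         (x0 \<cdot> bh) \<cdot> bh = (1/2 * form a b * form b x0) *s a + (1/2 * form a b) *s (x0 \<cdot> b0) \<and>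
         zero_part (*s) (\<cdot>) form a (xh \<cdot> bh) \<cdot> bh = (1/4 * form a b * (1 - form a b)) *s xh - (1/2 * form a b) *s (xh \<cdot> b0) + (1/4 * form b xh) *s bh \<and>
         (xh \<cdot> bh) \<cdot> bh = (1/4 * form a b * (1 - form a b)) *s xh - (1/2 * form a b) *s (xh \<cdot> b0) + (1/2 * form b xh) *s bh \<and>
         (xh \<cdot> b0) \<cdot> bh = (1/4 * (1 - form a b) * form b xh) *s a + (1/4 * form b xh) *s b0 \<and>
         (xh \<cdot> bh) \<cdot> b0 = (1/2 * (1 - form a b)) *s zero_part (*s) (\<cdot>) form a (bh \<cdot> xh) + (1/4 * form b xh) *s b0 \<and>
         (x0 \<cdot> b0) \<cdot> bh = (1/2 * (1 - form a b)) *s (bh \<cdot> x0) + (1/4 * form b x0) *s bh \<and>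
         (x0 \<cdot> bh) \<cdot> b0 = (1/4 * form b x0) *s bh"
proof -
  interpret frobenius_algebra scale mul form
    by fact
  have two: "(2::'f) \<noteq> 0"
  proof
    assume "(2::'f) = 0"
    \<comment> \<open>A characteristic dividing 2 but different from 2 would be 1, which is
      impossible in a field.\<close>
    then have "CHAR('f) dvd 2"
      using of_nat_eq_0_iff_char_dvd[of 2, where ?'a = 'f] by simp
    then have "CHAR('f) \<noteq> 0" "CHAR('f) \<le> 2"
      by (auto intro: dvd_imp_le intro!: Nat.gr0I)
    with assms(1) have "CHAR('f) = Suc 0"
      by linarith
    then show False
      by simp
  qed
  interpret A: frobenius_axis scale mul form a
    by unfold_locales (fact two assms)+
  \<comment> \<open>An actual decomposition identifies the components \<open>b0\<close> and
    \<open>bh\<close>, which are given by definite descriptions.\<close>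
  obtain y z where b: "a \<cdot> y = 0" "A.in_minus z" "b = form a b *s a + y + z"
    by (rule A.decomposition)
  then have "b0 = y" "bh = z"
    using assms A.zero_part_eq A.half_part_eq by simp_all
  note b = b[folded this]
  have "a \<cdot> bh = (1/2) *s bh"
    using b(2) A.in_eigenspace_half_iff by (simp add: eigenspace_def)
  then interpret axis_pair scale mul form a b b0 bh "1/2"
    using b two by unfold_locales (simp_all add: assms)
  have x0: "a \<cdot> x0 = 0" and xh: "a \<cdot> xh = (1/2) *s xh"
    using assms(7,8) by (simp_all add: eigenspace_def)
  \<comment> \<open>The statement has 1/4 and \<open>x\<close> as the innermost left factor; the
    lemmas have \<open>h * h\<close> and \<open>x\<close> on the right. \<open>quarter\<close> and
    \<open>comm\<close> reconcile the two forms.\<close>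
  have quarter: "1/4 = 1/2 * (1/2 :: 'f)"
    by simp
  have comm: "(x \<cdot> u) \<cdot> v = v \<cdot> (u \<cdot> x)" for x u v
    by (simp add: mul_commute)
  show ?thesis
    unfolding comm quarter mul_commute[of xh] mul_commute[of x0]
    using zero_part_mul_bh_minus[OF xh] b0_b0_minus[OF xh] b0_b0_plus[OF x0] bh_bh_plus[OF x0] bh_bh_minus[OF xh]
      bh_b0_minus[OF xh] b0_bh_minus[OF xh, folded zero_part_minus[OF xh]] bh_b0_plus[OF x0] b0_bh_plus[OF x0]
    by (simp only: simp_thms)
qed

end
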